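(* Let $R$ be a $*$-ring and let $a,b,c\in R$. Then the following are equivalent: (1) $a\in R_{lh(b,c)}^{\mathrm{cEP}}$, i.e. $a$ has a left hybrid core-EP-$(b,c)$-inverse. (2) There exists a positive integer $m$ such that $a^k\in R_{lh(b,c)}^{\mathrm{core}}$ for every $k\ge m$. (3) $a^m\in R_{lh(b,c)}^{\mathrm{core}}$ for some positive integer $m$. In this case (with $m$ as in (3)), $a_{lh(b,c)}^{\mathrm{cEP}}=a^{m-1}(a^m)_{lh(b,c)}^{\mathrm{core}}$.
   Context: A $*$-ring is an associative ring with identity with an involution $x\mapsto x^*$ satisfying $(x+y)^*=x^*+y^*$, $(xy)^*=y^*x^*$, $(x^* )^*=x$. For $x\in R$, $\ell(x)=\{r\in R: rx=0\}$. Core inverse: $a\in R$ is core invertible ($a\in R^{\mathrm{core}}$) if there is $x\in R$ with $ax^2=x$, $(ax)^*=ax$, $xa^2=a$; such $x$ is unique and denoted $a^{\mathrm{core}}$. Left hybrid $(b,c)$-inverse: $a\in R_{lh}^{(b,c)}$ if there is $x\in R$ with $xax=x$, $\ell(x)=\ell(b)$, $Rx=Rc$; such $x$ is unique and denoted $a_{lh}^{(b,c)}$. Left hybrid core-$(b,c)$-inverse: $a\in R_{lh(b,c)}^{\mathrm{core}}$ if $a\in R^{\mathrm{core}}$, $a\in R_{lh}^{(b,c)}$ and $a^{\mathrm{core}}=a_{lh}^{(b,c)}$; the common value is denoted $a_{lh(b,c)}^{\mathrm{core}}$. Left hybrid core-EP-$(b,c)$-inverse: $a\in R_{lh(b,c)}^{\mathrm{cEP}}$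 if there exist $x,y\in R$ with $a=x+y$, $x^*y=yx=0$, $x\in R_{lh(b,c)}^{\mathrm{core}}$ and $y$ nilpotent; then $a_{lh(b,c)}^{\mathrm{cEP}}$ denotes $x_{lh(b,c)}^{\mathrm{core}}$ (which does not depend on the decomposition). *)

theory Defs
  imports Main
begin

(* ring_1 would exclude the zero ring, in which 0 = 1; it is a legitimate star ring. *)
class star_ring = ring + monoid_mult +
  fixes star :: "'a \<Rightarrow> 'a"
  assumes star_add: "star (x + y) = star x + star y"
    and star_mult: "star (x * y) = star y * star x"
    and star_star: "star (star x) = x"

definition left_annihilator :: "'a::star_ring \<Rightarrow> 'a set" where
  "left_annihilator x = {r. r * x = 0}"

definition principal_left_ideal :: "'a::star_ring \<Rightarrow> 'a set" where
  "principal_left_ideal x = {r * x | r. True}"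

definition is_core_inverse :: "'a::star_ring \<Rightarrow> 'a \<Rightarrow> bool" where
  "is_core_inverse a x \<longleftrightarrow> a * x ^ 2 = x \<and> star (a * x) = a * x \<and> x * a ^ 2 = a"

definition core_invertible :: "'a::star_ring \<Rightarrow> bool" where
  "core_invertible a \<longleftrightarrow> (\<exists>x. is_core_inverse a x)"

definition core_inverse :: "'a::star_ring \<Rightarrow> 'a" where
  "core_inverse a = (THE x. is_core_inverse a x)"

definition is_lh_inverse :: "'a::star_ring \<Rightarrow> 'a \<Rightarrow> 'a \<Rightarrow> 'a \<Rightarrow> bool" where
  "is_lh_inverse b c a x \<longleftrightarrow>
     x * a * x = x \<and>
     left_annihilator x = left_annihilator b \<and>
     principal_left_ideal x = principal_left_ideal c"

definition lh_invertible :: "'a::star_ring \<Rightarrow> 'a \<Rightarrow> 'a \<Rightarrow> bool" where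
  "lh_invertible b c a \<longleftrightarrow> (\<exists>x. is_lh_inverse b c a x)"

definition lh_inverse :: "'a::star_ring \<Rightarrow> 'a \<Rightarrow> 'a \<Rightarrow> 'a" where
  "lh_inverse b c a = (THE x. is_lh_inverse b c a x)"

lemma is_core_inverse_unique:
  assumes "is_core_inverse a x" "is_core_inverse a y"
  shows "x = y"
proof -
  have x: "a * (x * x) = x" "star (a * x) = a * x" "x * (a * a) = a"
    and y: "a * (y * y) = y" "star (a * y) = a * y" "y * (a * a) = a"
    using assms by (simp_all add: is_core_inverse_def power2_eq_square)
  have axa: "a * x * a = a" by (metis x(1,3) mult.assoc)
  have aya: "a * y * a = a" by (metis y(1,3) mult.assoc)
  have "a * y = star ((a * x) * (a * y))"
    using axa y(2) by (metis mult.assoc)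
  also have "\<dots> = (a * y) * (a * x)" by (simp add: star_mult[of "a * x" "a * y"] x(2) y(2))
  also have "\<dots> = a * x" using aya by (metis mult.assoc)
  finally have eq: "a * y = a * x" .
  have "x = x * (a * x)" by (metis x(1,3) mult.assoc)
  also have "\<dots> = x * (a * y)" by (simp only: eq)
  also have "\<dots> = y" by (metis x(3) y(1) mult.assoc)
  finally show ?thesis .
qed

lemma is_lh_inverse_unique:
  assumes "is_lh_inverse b c a x" "is_lh_inverse b c a y"
  shows "x = y"
proof -
  have x: "x * a * x = x" and y: "y * a * y = y"
    and ann: "left_annihilator x = left_annihilator y"
    and ideal: "principal_left_ideal x = principal_left_ideal y"
    using assms by (simp_all add: is_lh_inverse_def)
  have "x * a - 1 \<in> left_annihilator x" by (simp add: left_annihilator_def algebra_simps x[unfolded mult.assoc])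
  then have "x * a - 1 \<in> left_annihilator y" by (simp only: ann)
  then have "x * a * y = y" by (simp add: left_annihilator_def left_diff_distrib)
  moreover have "x \<in> principal_left_ideal x"
    unfolding principal_left_ideal_def by (metis (mono_tags, lifting) mem_Collect_eq mult_1_left)
  then have "x \<in> principal_left_ideal y" by (simp only: ideal)
  then obtain t where "x = t * y" by (auto simp: principal_left_ideal_def)
  then have "x * a * y = x" using y by (metis mult.assoc)
  ultimately show ?thesis by simp
qed

definition lh_core_invertible :: "'a::star_ring \<Rightarrow> 'a \<Rightarrow> 'a \<Rightarrow> bool" where
  "lh_core_invertible b c a \<longleftrightarrow>
     core_invertible a \<and> lh_invertible b c a \<and> core_inverse a = lh_inverse b c a"

(* The common value of core_inverse a and lh_inverse b c a; only meaningful
   when lh_core_invertible b c a holds. *)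
definition lh_core_inverse :: "'a::star_ring \<Rightarrow> 'a \<Rightarrow> 'a \<Rightarrow> 'a" where
  "lh_core_inverse b c a = lh_inverse b c a"

definition nilpotent :: "'a::star_ring \<Rightarrow> bool" where
  "nilpotent y \<longleftrightarrow> (\<exists>n>0. y ^ n = 0)"

definition is_lh_cEP_decomposition :: "'a::star_ring \<Rightarrow> 'a \<Rightarrow> 'a \<Rightarrow> 'a \<Rightarrow> 'a \<Rightarrow> bool" where
  "is_lh_cEP_decomposition b c a x y \<longleftrightarrow>
     a = x + y \<and> star x * y = 0 \<and> y * x = 0 \<and> lh_core_invertible b c x \<and> nilpotent y"

definition lh_cEP_invertible :: "'a::star_ring \<Rightarrow> 'a \<Rightarrow> 'a \<Rightarrow> bool" where
  "lh_cEP_invertible b c a \<longleftrightarrow> (\<exists>x y. is_lh_cEP_decomposition b c a x y)"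

(* Meaningful only when lh_cEP_invertible b c a holds; uniqueness of z is the fact that
   the value does not depend on the decomposition, which is not assumed here. *)
definition lh_cEP_inverse :: "'a::star_ring \<Rightarrow> 'a \<Rightarrow> 'a \<Rightarrow> 'a" where
  "lh_cEP_inverse b c a =
     (THE z. \<exists>x y. is_lh_cEP_decomposition b c a x y \<and> z = lh_core_inverse b c x)"

end

theory Submission
  imports Defs
begin

text \<open>
  If \<open>a = x + y\<close> is a decomposition with \<open>y ^ n = 0\<close> and \<open>z\<close> is the core inverse of \<open>x\<close>,
  then \<open>y * z = 0\<close> and \<open>z * y = 0\<close>, so \<open>z\<close> interacts with \<open>a\<close> as it does with \<open>x\<close>, and \<open>z ^ k\<close> is
  the core inverse of \<open>a ^ k\<close> for \<open>k \<ge> n\<close>. Conversely, if \<open>v\<close> is the core inverse of \<open>a ^ m\<close>,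
  put \<open>z = a ^ (m - 1) * v\<close>; then \<open>a = a * z * a + (a - a * z * a)\<close> is a decomposition, and
  \<open>z\<close> is the core inverse of \<open>a * z * a\<close>. Throughout, the new core inverse has the same left
  annihilator and generates the same left ideal as the old one.
\<close>

section \<open>Left annihilators, left ideals and hybrid core inverses\<close>

lemma left_annihilator_subset:
  assumes "y = x * t"
  shows "left_annihilator x \<subseteq> left_annihilator y"
  using assms by (auto simp: left_annihilator_def mult.assoc[symmetric])

lemma principal_left_ideal_subset:
  assumes "y = t * x"
  shows "principal_left_ideal y \<subseteq> principal_left_ideal x"
  using assms by (auto simp: principal_left_ideal_def mult.assoc[symmetric])

text \<open>A relational form free of \<open>THE\<close>, naming the common value \<open>z\<close>
  directly; the outer inverse equation follows from \<open>is_core_inverse\<close>.\<close>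

definition is_lh_core_inverse :: "'a::star_ring \<Rightarrow> 'a \<Rightarrow> 'a \<Rightarrow> 'a \<Rightarrow> bool" where
  "is_lh_core_inverse b c a z \<longleftrightarrow>
     is_core_inverse a z \<and>
     left_annihilator z = left_annihilator b \<and>
     principal_left_ideal z = principal_left_ideal c"

lemma is_core_inverseD:
  assumes "is_core_inverse a x"
  shows "a * (x * x) = x" "star (a * x) = a * x" "x * (a * a) = a"
    "x * (a * x) = x" "a * (x * a) = a"
proof -
  show *: "a * (x * x) = x" "star (a * x) = a * x" "x * (a * a) = a"
    using assms by (simp_all add: is_core_inverse_def power2_eq_square)
  show "x * (a * x) = x" "a * (x * a) = a"
    by (metis *(1,3) mult.assoc)+
qed

lemma core_inverse_eqI:
  "is_core_inverse a x \<Longrightarrow> core_inverse a = x"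
  unfolding core_inverse_def using is_core_inverse_unique by blast

lemma lh_inverse_eqI:
  "is_lh_inverse b c a x \<Longrightarrow> lh_inverse b c a = x"
  unfolding lh_inverse_def using is_lh_inverse_unique by blast

lemma is_lh_core_inverse_iff:
  "is_lh_core_inverse b c a z \<longleftrightarrow> is_core_inverse a z \<and> is_lh_inverse b c a z"
  unfolding is_lh_core_inverse_def is_lh_inverse_def
  using is_core_inverseD(4)[of a z] by (auto simp: mult.assoc)

lemma lh_core_invertible_iff:
  "lh_core_invertible b c a \<longleftrightarrow> (\<exists>z. is_lh_core_inverse b c a z)"
  unfolding lh_core_invertible_def core_invertible_def lh_invertible_def is_lh_core_inverse_iff
  using core_inverse_eqI[of a] lh_inverse_eqI[of b c a] by metis

lemma lh_core_inverse_eqI: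
  "is_lh_core_inverse b c a z \<Longrightarrow> lh_core_inverse b c a = z"
  by (simp add: lh_core_inverse_def is_lh_core_inverse_iff lh_inverse_eqI)

text \<open>Elements that are right multiples of each other have equal left annihilators; left
  multiples of each other generate equal left ideals. \<open>a\<close> and \<open>a'\<close>
  themselves need not be related.\<close>

lemma is_lh_core_inverse_transfer:
  assumes "is_lh_core_inverse b c a z" "is_core_inverse a' w"
    and "w = z * s" "z = w * s'" "w = t * z" "z = t' * w"
  shows "is_lh_core_inverse b c a' w"
proof -
  have "left_annihilator w = left_annihilator z"
    using left_annihilator_subset[OF assms(3)] left_annihilator_subset[OF assms(4)] by (rule equalityI[rotated])
  moreover have "principal_left_ideal w = principal_left_ideal z"
    using principal_left_ideal_subset[OF assms(5)] principal_left_ideal_subset[OF assms(6)] by (rule equalityI)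
  ultimately show ?thesis
    using assms(1,2) by (simp add: is_lh_core_inverse_def)
qed

section \<open>From a decomposition to core inverses of powers\<close>

lemma power_absorb_left:
  fixes x z :: "'a::monoid_mult"
  assumes "x * (z * z) = z"
  shows "x ^ k * z ^ Suc k = z"
proof (induction k)
  case (Suc k)
  have "x ^ Suc k * z ^ Suc (Suc k) = x ^ k * (x * (z * z)) * z ^ k"
    by (simp only: power_Suc2[of x k] power_Suc[of z] mult.assoc)
  also have "\<dots> = x ^ k * z ^ Suc k"
    by (simp only: assms mult.assoc power_Suc)
  finally show ?case
    using Suc.IH by simp
qed simp

text \<open>As \<open>y * x = 0\<close>, every nonzero word in the expansion other than
  \<open>y ^ k\<close> starts with \<open>x\<close>.\<close>

lemma power_decomposition:
  fixes x y :: "'a::star_ring"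
  assumes "y * x = 0" and "k > 0"
  shows "\<exists>w. (x + y) ^ k = x * w + y ^ k"
  using assms(2)
proof (induction k rule: nat_induct_non_zero)
  case 1
  show ?case by (rule exI[of _ 1]) simp
next
  case (Suc k)
  then obtain w where w: "(x + y) ^ k = x * w + y ^ k" by blast
  have "y * (x * w) = 0" by (metis assms(1) mult.assoc mult_zero_left)
  then have "(x + y) ^ Suc k = x * (x * w + y ^ k) + y ^ Suc k"
    by (simp add: w algebra_simps)
  then show ?case by blast
qed

text \<open>The second equation recovers \<open>z\<close> from \<open>z ^ k\<close>; it serves to
  show independence of the decomposition.\<close>

lemma is_lh_core_inverse_power:
  assumes dec: "a = x + y" "star x * y = 0" "y * x = 0"
    and z: "is_lh_core_inverse b c x z"
    and n: "y ^ n = 0" "n > 0" "k \<ge> n"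
  shows "is_lh_core_inverse b c (a ^ k) (z ^ k)" and "a ^ (k - 1) * z ^ k = z"
proof -
  obtain j where k: "k = Suc j" using n by (cases k) auto
  note c = is_core_inverseD[OF z[unfolded is_lh_core_inverse_def, THEN conjunct1]]
  have yz: "y * z = 0"
    by (metis c(1) dec(3) mult.assoc mult_zero_left)
  \<comment> \<open>Since \<open>x * z\<close> is self-adjoint,
    \<open>z = z * (x * z) = z * star z * star x\<close>, and \<open>star x\<close> kills
    \<open>y\<close>.\<close>
  have zy: "z * y = 0"
    by (metis c(2,4) dec(2) mult.assoc mult_zero_right star_mult)
  have az: "a * z = x * z" and za: "z * a = z * x"
    by (simp_all add: dec(1) algebra_simps yz zy)
  have azz: "a * (z * z) = z"
    by (metis az c(1) mult.assoc)
  have pow: "a ^ i * z ^ Suc i = z" for i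
    by (rule power_absorb_left[OF azz])
  show "a ^ (k - 1) * z ^ k = z"
    using pow[of j] k by simp
  \<comment> \<open>Once \<open>y ^ i\<close> vanishes, \<open>a ^ i\<close> is a right multiple of
    \<open>x\<close>, which \<open>z * x\<close> fixes.\<close>
  have za_pow: "z * a ^ Suc i = a ^ i" if "i \<ge> n" for i
  proof -
    have "y ^ i = 0"
      using n(1) that by (metis le_add_diff_inverse mult_zero_left power_add)
    moreover have "i > 0"
      using n(2) that by simp
    ultimately obtain w where w: "a ^ i = x * w"
      using power_decomposition[OF dec(3), of i] unfolding dec(1) by auto
    have "z * a ^ Suc i = z * x * a ^ i"
      by (simp add: za mult.assoc[symmetric])
    also have "\<dots> = a ^ i"
      unfolding w by (metis c(3) mult.assoc)
    finally show ?thesis .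
  qed
  have zk: "z ^ i * a ^ (i + k) = a ^ k" for i
  proof (induction i)
    case (Suc i)
    have "z ^ Suc i * a ^ (Suc i + k) = z ^ i * (z * a ^ Suc (i + k))"
      by (simp only: power_Suc2[of z i] mult.assoc add_Suc)
    also have "z * a ^ Suc (i + k) = a ^ (i + k)"
      using za_pow n(3) by simp
    finally show ?case using Suc.IH by simp
  qed simp
  have akz: "a ^ k * z ^ k = x * z"
    using pow[of j] az by (simp add: k mult.assoc)
  \<comment> \<open>Makes \<open>z = z * x * z\<close> a right multiple of \<open>z ^ k\<close>, as
    the transfer requires.\<close>
  have zkx: "z ^ Suc i * x ^ Suc i = z * x" for i
  proof (induction i)
    case (Suc i)
    have "z ^ Suc (Suc i) * x ^ Suc (Suc i) = z ^ Suc i * (z * (x * x)) * x ^ i"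
      by (simp only: power_Suc2[of z "Suc i"] power_Suc[of x] mult.assoc)
    then show ?case
      using Suc.IH by (simp only: c(3) mult.assoc power_Suc)
  qed simp
  have core: "is_core_inverse (a ^ k) (z ^ k)"
    unfolding is_core_inverse_def power2_eq_square
  proof (intro conjI)
    have "a ^ k * (z ^ k * z ^ k) = x * z * z * z ^ j"
      by (simp add: mult.assoc[symmetric] akz) (simp add: k mult.assoc)
    then show "a ^ k * (z ^ k * z ^ k) = z ^ k"
      using c(1) by (simp add: k mult.assoc)
    show "star (a ^ k * z ^ k) = a ^ k * z ^ k"
      by (simp add: akz c(2))
    show "z ^ k * (a ^ k * a ^ k) = a ^ k"
      using zk[of k] by (simp add: power_add)
  qed
  show "is_lh_core_inverse b c (a ^ k) (z ^ k)"
  proof (rule is_lh_core_inverse_transfer[OF z core])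
    show "z ^ k = z * z ^ j" by (simp add: k)
    show "z ^ k = z ^ j * z" by (simp add: k power_commutes)
    show "z = a ^ j * z ^ k" using pow[of j] by (simp add: k)
    show "z = z ^ k * (x ^ k * z)"
      using zkx[of j] c(4) unfolding k by (metis mult.assoc)
  qed
qed

section \<open>From a core inverse of one power to a decomposition\<close>

text \<open>With \<open>p = a ^ Suc j\<close>, the element \<open>a * z = p * v\<close> is a
  self-adjoint idempotent, and \<open>x\<close> is its product with \<open>a\<close>.\<close>

lemma decomposition_of_power_core_inverse:
  assumes v: "is_lh_core_inverse b c (a ^ Suc j) v"
  defines "z \<equiv> a ^ j * v"
  defines "x \<equiv> a * z * a"
  shows "is_lh_cEP_decomposition b c a x (a - x)" and "is_lh_core_inverse b c x z"
proof -
  define p where "p = a ^ Suc j"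
  note c = is_core_inverseD[OF v[unfolded is_lh_core_inverse_def, THEN conjunct1], folded p_def]
  have aj: "a * a ^ j = p" "a ^ j * a = p"
    by (simp_all add: p_def power_commutes)
  have ap: "a * (p * u) = p * (a * u)" for u
    by (metis aj mult.assoc)
  have ajp: "a ^ j * (p * u) = p * (a ^ j * u)" for u
    by (metis aj mult.assoc)
  have vpp: "v * (p * (p * u)) = p * u" for u
    by (metis c(3) mult.assoc)
  have az: "a * z = p * v"
    by (simp add: z_def aj(1) mult.assoc[symmetric])
  \<comment> \<open>Writing \<open>p\<close> as \<open>p * p * t\<close> lets \<open>v\<close> move
    past \<open>a\<close> in front of \<open>p\<close>: \<open>a\<close> commutes with
    \<open>p\<close>, and \<open>v * p\<close> fixes right multiples of \<open>p\<close>.\<close>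
  define t where "t = v * (v * p)"
  have t: "p * (p * t) = p"
    unfolding t_def by (metis c(1,5) mult.assoc)
  have va: "v * (a * p) = a * (p * t)"
  proof -
    have "v * (a * p) = v * (a * (p * (p * t)))"
      by (simp only: t)
    also have "\<dots> = a * (p * t)"
      by (simp only: ap vpp)
    finally show ?thesis .
  qed
  have zap: "z * (a * p) = p"
  proof -
    have "z * (a * p) = a ^ j * (a * (p * t))"
      by (simp only: z_def mult.assoc va)
    also have "\<dots> = p"
      by (simp only: mult.assoc[symmetric] aj) (simp only: mult.assoc t)
    finally show ?thesis .
  qed
  have zap': "z * (a * (p * u)) = p * u" for u
    by (metis zap mult.assoc)
  \<comment> \<open>Exhibits \<open>z\<close> as a right multiple of \<open>p\<close>, so that
    \<open>z * a\<close> fixes \<open>z\<close>.\<close>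
  define w where "w = a ^ j * (v * v)"
  have zp: "z = p * w"
    unfolding w_def z_def by (simp only: ajp[symmetric] c(1))
  have azz: "a * (z * z) = z"
  proof -
    have "a * (z * z) = a * z * z"
      by (simp only: mult.assoc)
    also have "\<dots> = p * v * (p * w)"
      by (simp only: az) (simp only: zp)
    also have "\<dots> = z"
      unfolding zp by (metis c(5) mult.assoc)
    finally show ?thesis .
  qed
  have zaz: "z * (a * z) = z"
    using zap'[of w] by (simp only: zp[symmetric])
  have xz: "x * z = a * z"
    unfolding x_def by (simp only: mult.assoc zaz)
  have x_eq: "x = p * (v * a)"
    unfolding x_def az by (rule mult.assoc)
  have zax: "z * (a * x) = x"
    unfolding x_eq by (rule zap')
  have core: "is_core_inverse x z"
    unfolding is_core_inverse_def power2_eq_square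
  proof (intro conjI)
    show "x * (z * z) = z"
      by (simp only: mult.assoc[symmetric] xz) (simp only: mult.assoc azz)
    show "star (x * z) = x * z"
      unfolding xz az by (rule c(2))
    have "z * x = z * a"
      unfolding x_def by (metis zaz mult.assoc)
    then show "z * (x * x) = x"
      by (metis zax mult.assoc)
  qed
  show lh: "is_lh_core_inverse b c x z"
  proof (rule is_lh_core_inverse_transfer[OF v core])
    show "z = a ^ j * v" by (simp only: z_def)
    show "v = v * a * z" by (metis az c(4) mult.assoc)
    show "z = v * (p * (p * w))"
      by (simp only: vpp zp)
    show "v = z * (a * (p * (v * v)))"
      unfolding zap' by (rule c(1)[symmetric])
  qed
  define y where "y = a - x"
  have yx: "y * x = 0"
  proof -
    have "x * x = a * (z * (a * x))"
      unfolding x_def by (simp only: mult.assoc)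
    then show ?thesis
      by (simp add: y_def left_diff_distrib zax)
  qed
  \<comment> \<open>From \<open>y * x = 0\<close> comes \<open>y * a = y * y\<close>. At
    \<open>i = Suc j\<close> the right side is \<open>y * p\<close>, which is zero because
    \<open>x * p = a * p\<close>.\<close>
  have y_pow: "y ^ Suc i = y * a ^ i" for i
  proof (induction i)
    case (Suc i)
    have "y * a = y * y"
      using yx by (simp add: y_def right_diff_distrib)
    then show ?case
      using Suc.IH by (metis mult.assoc power_Suc)
  qed simp
  have "y ^ Suc (Suc j) = 0"
  proof -
    have "x * p = a * p"
      unfolding x_def by (simp only: mult.assoc zap)
    then show ?thesis
      by (simp only: y_pow p_def[symmetric]) (simp add: y_def left_diff_distrib)
  qed
  then have "nilpotent y"
    unfolding nilpotent_def by blast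
  \<comment> \<open>Self-adjointness of \<open>a * z\<close> brings it to the right end of
    \<open>star x\<close>, where it kills \<open>y = a - a * z * a\<close>.\<close>
  moreover have "star x * y = 0"
  proof -
    have "star x = star a * (a * z)"
      unfolding x_def star_mult[of "a * z"] unfolding az c(2) ..
    moreover have "a * z * y = 0"
      unfolding y_def x_def right_diff_distrib by (metis zaz mult.assoc right_minus_eq)
    ultimately show ?thesis by (simp add: mult.assoc)
  qed
  ultimately show "is_lh_cEP_decomposition b c a x (a - x)"
    using yx lh unfolding is_lh_cEP_decomposition_def lh_core_invertible_iff y_def by auto
qed

section \<open>Independence of the decomposition and the equivalences\<close>

lemma lh_cEP_decomposition_powers:
  assumes "is_lh_cEP_decomposition b c a x y"
  obtains n where "n > 0"
    "\<And>k. k \<ge> n \<Longrightarrow> is_lh_core_inverse b c (a ^ k) (lh_core_inverse b c x ^ k)"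
    "\<And>k. k \<ge> n \<Longrightarrow> a ^ (k - 1) * lh_core_inverse b c x ^ k = lh_core_inverse b c x"
proof -
  from assms have dec: "a = x + y" "star x * y = 0" "y * x = 0"
    unfolding is_lh_cEP_decomposition_def by auto
  from assms obtain z n where z: "is_lh_core_inverse b c x z" and n: "y ^ n = 0" "n > 0"
    unfolding is_lh_cEP_decomposition_def lh_core_invertible_iff nilpotent_def by auto
  show thesis
    using that[of n] is_lh_core_inverse_power[OF dec z n] n(2)
    unfolding lh_core_inverse_eqI[OF z] by blast
qed

text \<open>For \<open>k\<close> beyond both bounds, the two \<open>k\<close>-th powers are the core
  inverse of the same \<open>a ^ k\<close>, hence equal; multiplying by \<open>a ^ (k - 1)\<close>
  removes the power.\<close>

lemma lh_core_inverse_decomposition_unique: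
  assumes "is_lh_cEP_decomposition b c a x y" "is_lh_cEP_decomposition b c a x' y'"
  shows "lh_core_inverse b c x = lh_core_inverse b c x'"
proof -
  obtain n where n:
    "\<And>k. k \<ge> n \<Longrightarrow> is_lh_core_inverse b c (a ^ k) (lh_core_inverse b c x ^ k)"
    "\<And>k. k \<ge> n \<Longrightarrow> a ^ (k - 1) * lh_core_inverse b c x ^ k = lh_core_inverse b c x"
    using lh_cEP_decomposition_powers[OF assms(1)] by metis
  obtain n' where n':
    "\<And>k. k \<ge> n' \<Longrightarrow> is_lh_core_inverse b c (a ^ k) (lh_core_inverse b c x' ^ k)"
    "\<And>k. k \<ge> n' \<Longrightarrow> a ^ (k - 1) * lh_core_inverse b c x' ^ k = lh_core_inverse b c x'"
    using lh_cEP_decomposition_powers[OF assms(2)] by metis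
  let ?k = "max n n'"
  have "lh_core_inverse b c x ^ ?k = lh_core_inverse b c x' ^ ?k"
    using lh_core_inverse_eqI[OF n(1)[of ?k]] lh_core_inverse_eqI[OF n'(1)[of ?k]] by simp
  then show ?thesis
    using n(2)[of ?k] n'(2)[of ?k] by simp
qed

lemma lh_cEP_inverse_eqI:
  assumes "is_lh_cEP_decomposition b c a x y"
  shows "lh_cEP_inverse b c a = lh_core_inverse b c x"
  unfolding lh_cEP_inverse_def
  using assms lh_core_inverse_decomposition_unique[OF _ assms] by blast

theorem theorem5p1:
  fixes a b c :: "'a::star_ring"
  shows "(lh_cEP_invertible b c a \<longleftrightarrow> (\<exists>m>0. \<forall>k\<ge>m. lh_core_invertible b c (a ^ k))) \<and>
         (lh_cEP_invertible b c a \<longleftrightarrow> (\<exists>m>0. lh_core_invertible b c (a ^ m))) \<and>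
         (\<forall>m>0. lh_core_invertible b c (a ^ m) \<longrightarrow>
            lh_cEP_inverse b c a = a ^ (m - 1) * lh_core_inverse b c (a ^ m))"
proof -
  have 12: "\<exists>m>0. \<forall>k\<ge>m. lh_core_invertible b c (a ^ k)" if "lh_cEP_invertible b c a"
    using that lh_cEP_decomposition_powers
    unfolding lh_cEP_invertible_def lh_core_invertible_iff by metis
  have 31: "lh_cEP_invertible b c a \<and>
      lh_cEP_inverse b c a = a ^ (m - 1) * lh_core_inverse b c (a ^ m)"
    if m: "m > 0" "lh_core_invertible b c (a ^ m)" for m
  proof -
    obtain j where j: "m = Suc j" using m(1) by (cases m) auto
    obtain v where v: "is_lh_core_inverse b c (a ^ Suc j) v"
      using m(2) unfolding j lh_core_invertible_iff by blast
    note dec = decomposition_of_power_core_inverse[OF v]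
    have "lh_cEP_inverse b c a = a ^ j * v"
      using lh_cEP_inverse_eqI[OF dec(1)] lh_core_inverse_eqI[OF dec(2)] by simp
    then show ?thesis
      using dec(1) lh_core_inverse_eqI[OF v] unfolding lh_cEP_invertible_def j by auto
  qed
  \<comment> \<open>The remaining implication, from all large exponents to a single one, is the case
    \<open>k = m\<close>.\<close>
  show ?thesis
    using 12 31 by blast
qed

end
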